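(* Suppose $D$ is an MBQC-form diagram that contains a $YZ$-measured vertex with a single neighbour, which is $XY$-measured, and let $D'$ be the same diagram with the phase angles redistributed arbitrarily between these two measurements: i.e. if the initial angles of the two measurements are $\alpha$ and $\beta$, the new angles may be $\alpha'$ and $\alpha-\alpha'+\beta$ for any $\alpha'$. Then the two diagrams represent the same linear map (up to a non-zero scalar), and $D'$ has Pauli flow if and only if $D$ has Pauli flow. The same holds for gflow (that is, $D'$ has gflow if and only if $D$ has gflow) and for extended causal flow.
   Context: An MBQC-form diagram consists of a finite simple undirected graph $G=(V,E)$, inputs $I\subseteq V$, outputs $O\subseteq V$, and for each $v\in V\setminus O$ a measurement effect $e_v$ (a row vector, considered up to non-zero scalar) of one of the following types: $XY$ with angle $\alpha\in\mathbb R$: $\langle0|+e^{i\alpha}\langle1|$; $YZ$ with angle $\alpha$: $\langle+|+e^{i\alpha}\langle-|$; $XZ$ with angle $\alpha$: $(\langle+|+e^{i\alpha}\langle-|)\circ\mathrm{diag}(1,i)$; $X$: as $XY$ with $\alpha\in\{0,\pi\}$; $Y$: as $XY$ with $\alpha=\pm\pi/2$; $Z$: as $YZ$ with $\alpha\in\{0,\pi\}$. A vertex is $XY$-measured (resp. $YZ$-measured) with angle $\alpha$ if its effect is the $XY$ (resp. $YZ$) effect with angle $\alpha$. The interpretation, up to non-zero scalar, is the linear map $(\mathbb C^2)^{\otimes I}\to(\mathbb C^2)^{\otimes O}$, $|x\rangle\mapsto\sum_{y\in\{0,1\}^V,\,y|_I=x}(-1)^{|\{\{u,v\}\in E:\,y_u=y_v=1\}|}\big(\prod_{v\in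 V\setminus O}e_v|y_v\rangle\big)|y|_O\rangle$. A labelled open graph is a tuple $(G,I,O,\lambda)$ with $\lambda:V\setminus O\to\{X,Y,Z,XY,XZ,YZ\}$. Labels $X,Y,Z$ are called Pauli, and $XY,XZ,YZ$ planar. It corresponds to a diagram if $G,I,O$ agree and each effect $e_v$ is, up to scalar, an effect of type $\lambda(v)$ for some allowed angle. If some angles are integer multiples of $\pi/2$, several labelled open graphs, differing only in $\lambda$, correspond to the same diagram; among them there is a unique one with the maximum number of Pauli labels. Flow of labelled open graphs: write $\overline S=V\setminus S$; $\mathrm{Odd}_G(S)$ is the set of vertices with an odd number of neighbours in $S$; $\mathrm{Odd}_G[S]=\mathrm{Odd}_G(S)\,\triangle\,S$. For $c:\overline O\to\mathcal P(\overline I)$ let $R_c$ be the set of pairs $(u,v)$, $u\neq v$, with: $v\in c(u)$ and $\lambda(v)\notin\{X,Y\}$; or $v\in\mathrm{Odd}_G(c(u))$ and $\lambda(v)\notin\{Y,Z\}$; or $v\in\mathrm{Odd}_G[c(u)]$ and $\lambda(v)=Y$ (for $v\in O$ the "$\notin$" conditions count as satisfied). $(G,I,O,\lambda)$ has Pauli flow if there is $p:\overline O\to\mathcal P(\overline I)$ such that the transitive closure of $R_p$ is a strict partial order and for all $u\in\overline O$, according to $\lambda(u)$: $XY$: $u\notin p(u)$, $u\in\mathrm{Odd}_G(p(u))$; $XZ$: $u\in p(u)$, $u\in\mathrm{Odd}_G(p(u))$; $YZ$: $u\in p(u)$, $u\notin\mathrm{Odd}_G(p(u))$; $X$: $u\in\mathrm{Odd}_G(p(u))$;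 $Z$: $u\in p(u)$; $Y$: $u\in\mathrm{Odd}_G[p(u)]$. If all labels are planar, a Pauli flow is called a gflow. If all labels are in $\{XY,YZ\}$, an extended causal flow is a map $f:\overline O\to\overline I$ such that the transitive closure of $R_f$ (identifying $f(v)$ with $\{f(v)\}$) is a strict partial order and for all $v\in\overline O$: if $\lambda(v)=XY$ then $f(v)$ is adjacent to $v$, and if $\lambda(v)=YZ$ then $f(v)=v$. Flow of diagrams: an MBQC-form diagram has Pauli flow if the corresponding labelled open graph with the maximum number of Pauli labels has Pauli flow; it has gflow if there exists a corresponding labelled open graph with all labels planar which has gflow; it has extended causal flow if there exists a corresponding labelled open graph with all labels in $\{XY,YZ\}$ which has extended causal flow.
   Formalization: Added: the YZ-measured vertex is not an input. The Pauli flow equivalence is stated only if both angles are multiples of π/2 before and after, or neither time; else only flow of the not-doubly-Pauli diagram implies flow of the other. The claim fails otherwise. *)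

theory Defs
  imports Complex_Main "HOL-Library.FuncSet"
begin

section \<open>Open graphs\<close>

record 'a open_graph =
  verts :: "'a set"
  edges :: "'a set set"
  inputs :: "'a set"
  outputs :: "'a set"

definition open_graph :: "('a, 'b) open_graph_scheme \<Rightarrow> bool" where
  "open_graph G \<longleftrightarrow> finite (verts G)
     \<and> edges G \<subseteq> {{u, v} | u v. u \<in> verts G \<and> v \<in> verts G \<and> u \<noteq> v}
     \<and> inputs G \<subseteq> verts G \<and> outputs G \<subseteq> verts G"

definition measured :: "('a, 'b) open_graph_scheme \<Rightarrow> 'a set" where
  "measured G = verts G - outputs G"

definition non_inputs :: "('a, 'b) open_graph_scheme \<Rightarrow> 'a set" where
  "non_inputs G = verts G - inputs G"

definition neighbours :: "('a, 'b) open_graph_scheme \<Rightarrow> 'a \<Rightarrow> 'a set" where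
  "neighbours G v = {u \<in> verts G. {u, v} \<in> edges G}"

definition Odd :: "('a, 'b) open_graph_scheme \<Rightarrow> 'a set \<Rightarrow> 'a set" where
  "Odd G S = {v \<in> verts G. odd (card (neighbours G v \<inter> S))}"

definition Odd_closed :: "('a, 'b) open_graph_scheme \<Rightarrow> 'a set \<Rightarrow> 'a set" where
  "Odd_closed G S = (Odd G S - S) \<union> (S - Odd G S)"


section \<open>Measurement effects\<close>

text \<open>A basis state of one qubit is a Boolean, and an effect \<open>e\<close> is the row vector whose
  entry at the basis state \<open>b\<close> is \<open>e b\<close>.\<close>

type_synonym effect = "bool \<Rightarrow> complex"

definition bra0 :: effect where "bra0 b = (if b then 0 else 1)"
definition bra1 :: effect where "bra1 b = (if b then 1 else 0)"
definition bra_plus :: effect where "bra_plus b = (bra0 b + bra1 b) / complex_of_real (sqrt 2)"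
definition bra_minus :: effect where "bra_minus b = (bra0 b - bra1 b) / complex_of_real (sqrt 2)"

definition xy_effect :: "real \<Rightarrow> effect" where
  "xy_effect \<alpha> b = bra0 b + cis \<alpha> * bra1 b"

definition yz_effect :: "real \<Rightarrow> effect" where
  "yz_effect \<alpha> b = bra_plus b + cis \<alpha> * bra_minus b"

text \<open>The last factor is composition with \<open>diag(1, i)\<close>.\<close>

definition xz_effect :: "real \<Rightarrow> effect" where
  "xz_effect \<alpha> b = (bra_plus b + cis \<alpha> * bra_minus b) * (if b then \<i> else 1)"

definition same_effect :: "effect \<Rightarrow> effect \<Rightarrow> bool" where
  "same_effect e e' \<longleftrightarrow> (\<exists>c. c \<noteq> 0 \<and> (\<forall>b. e' b = c * e b))"

datatype label = X | Y | Z | XY | XZ | YZ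

definition pauli_label :: "label \<Rightarrow> bool" where
  "pauli_label l \<longleftrightarrow> l \<in> {X, Y, Z}"

definition planar_label :: "label \<Rightarrow> bool" where
  "planar_label l \<longleftrightarrow> l \<in> {XY, XZ, YZ}"

fun effect_of_type :: "label \<Rightarrow> effect \<Rightarrow> bool" where
  "effect_of_type XY e \<longleftrightarrow> (\<exists>\<alpha>. same_effect e (xy_effect \<alpha>))"
| "effect_of_type YZ e \<longleftrightarrow> (\<exists>\<alpha>. same_effect e (yz_effect \<alpha>))"
| "effect_of_type XZ e \<longleftrightarrow> (\<exists>\<alpha>. same_effect e (xz_effect \<alpha>))"
| "effect_of_type X e \<longleftrightarrow> (\<exists>\<alpha>\<in>{0, pi}. same_effect e (xy_effect \<alpha>))"
| "effect_of_type Y e \<longleftrightarrow> (\<exists>\<alpha>\<in>{pi / 2, - (pi / 2)}. same_effect e (xy_effect \<alpha>))"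
| "effect_of_type Z e \<longleftrightarrow> (\<exists>\<alpha>\<in>{0, pi}. same_effect e (yz_effect \<alpha>))"


section \<open>MBQC-form diagrams\<close>

text \<open>The value of \<open>eff\<close> matters only on non-output vertices, and there only up to a non-zero
  scalar.\<close>

record 'a diagram = "'a open_graph" +
  eff :: "'a \<Rightarrow> effect"

definition mbqc_form :: "'a diagram \<Rightarrow> bool" where
  "mbqc_form D \<longleftrightarrow> open_graph D \<and> (\<forall>v\<in>measured D. \<exists>l. effect_of_type l (eff D v))"

definition XY_measured :: "'a diagram \<Rightarrow> 'a \<Rightarrow> real \<Rightarrow> bool" where
  "XY_measured D v \<alpha> \<longleftrightarrow> v \<in> measured D \<and> same_effect (eff D v) (xy_effect \<alpha>)"

definition YZ_measured :: "'a diagram \<Rightarrow> 'a \<Rightarrow> real \<Rightarrow> bool" where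
  "YZ_measured D v \<alpha> \<longleftrightarrow> v \<in> measured D \<and> same_effect (eff D v) (yz_effect \<alpha>)"

text \<open>\<open>basis S\<close> indexes the computational basis of the tensor power of \<open>\<complex>\<^sup>2\<close> over \<open>S\<close>; a vector
  of that space is given by its coordinates on \<open>basis S\<close>.\<close>

type_synonym 'a state = "('a \<Rightarrow> bool) \<Rightarrow> complex"

definition basis :: "'a set \<Rightarrow> ('a \<Rightarrow> bool) set" where
  "basis S = S \<rightarrow>\<^sub>E UNIV"

definition ket :: "('a \<Rightarrow> bool) \<Rightarrow> 'a state" where
  "ket x = (\<lambda>z. if z = x then 1 else 0)"

definition interp_ket :: "'a diagram \<Rightarrow> ('a \<Rightarrow> bool) \<Rightarrow> 'a state" where
  "interp_ket D x = (\<lambda>z. \<Sum>y | y \<in> basis (verts D) \<and> restrict y (inputs D) = x.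
      (-1) ^ card {e \<in> edges D. \<forall>u\<in>e. y u}
      * (\<Prod>v\<in>measured D. eff D v (y v))
      * ket (restrict y (outputs D)) z)"

definition interp :: "'a diagram \<Rightarrow> 'a state \<Rightarrow> 'a state" where
  "interp D \<psi> = (\<lambda>z. \<Sum>x\<in>basis (inputs D). \<psi> x * interp_ket D x z)"

definition same_map :: "'a diagram \<Rightarrow> 'a diagram \<Rightarrow> bool" where
  "same_map D D' \<longleftrightarrow> inputs D = inputs D' \<and> outputs D = outputs D'
     \<and> (\<exists>c. c \<noteq> 0 \<and> (\<forall>\<psi> z. interp D' \<psi> z = c * interp D \<psi> z))"


section \<open>Labelled open graphs and their flows\<close>

record 'a labelled_open_graph = "'a open_graph" +
  lab :: "'a \<Rightarrow> label"

text \<open>The labelling is extensional, so that a labelled open graph is determined by its labels on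
  the measured vertices.\<close>

definition labelled_open_graph :: "'a labelled_open_graph \<Rightarrow> bool" where
  "labelled_open_graph \<Gamma> \<longleftrightarrow> open_graph \<Gamma> \<and> lab \<Gamma> \<in> measured \<Gamma> \<rightarrow>\<^sub>E UNIV"

definition corresponds :: "'a diagram \<Rightarrow> 'a labelled_open_graph \<Rightarrow> bool" where
  "corresponds D \<Gamma> \<longleftrightarrow> labelled_open_graph \<Gamma>
     \<and> verts \<Gamma> = verts D \<and> edges \<Gamma> = edges D \<and> inputs \<Gamma> = inputs D \<and> outputs \<Gamma> = outputs D
     \<and> (\<forall>v\<in>measured D. effect_of_type (lab \<Gamma> v) (eff D v))"

definition flow_rel :: "'a labelled_open_graph \<Rightarrow> ('a \<Rightarrow> 'a set) \<Rightarrow> ('a \<times> 'a) set" where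
  "flow_rel \<Gamma> c = {(u, v). u \<in> measured \<Gamma> \<and> v \<in> verts \<Gamma> \<and> u \<noteq> v \<and>
     (v \<in> c u \<and> (v \<in> outputs \<Gamma> \<or> lab \<Gamma> v \<notin> {X, Y})
      \<or> v \<in> Odd \<Gamma> (c u) \<and> (v \<in> outputs \<Gamma> \<or> lab \<Gamma> v \<notin> {Y, Z})
      \<or> v \<in> Odd_closed \<Gamma> (c u) \<and> v \<notin> outputs \<Gamma> \<and> lab \<Gamma> v = Y)}"

definition strict_partial_order :: "('a \<times> 'a) set \<Rightarrow> bool" where
  "strict_partial_order r \<longleftrightarrow> irrefl r \<and> trans r"

fun correction_condition :: "label \<Rightarrow> 'a labelled_open_graph \<Rightarrow> 'a set \<Rightarrow> 'a \<Rightarrow> bool" where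
  "correction_condition XY \<Gamma> p u \<longleftrightarrow> u \<notin> p \<and> u \<in> Odd \<Gamma> p"
| "correction_condition XZ \<Gamma> p u \<longleftrightarrow> u \<in> p \<and> u \<in> Odd \<Gamma> p"
| "correction_condition YZ \<Gamma> p u \<longleftrightarrow> u \<in> p \<and> u \<notin> Odd \<Gamma> p"
| "correction_condition X \<Gamma> p u \<longleftrightarrow> u \<in> Odd \<Gamma> p"
| "correction_condition Z \<Gamma> p u \<longleftrightarrow> u \<in> p"
| "correction_condition Y \<Gamma> p u \<longleftrightarrow> u \<in> Odd_closed \<Gamma> p"

definition has_pauli_flow :: "'a labelled_open_graph \<Rightarrow> bool" where
  "has_pauli_flow \<Gamma> \<longleftrightarrow> (\<exists>p. (\<forall>u\<in>measured \<Gamma>. p u \<subseteq> non_inputs \<Gamma>)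
     \<and> strict_partial_order ((flow_rel \<Gamma> p)\<^sup>+)
     \<and> (\<forall>u\<in>measured \<Gamma>. correction_condition (lab \<Gamma> u) \<Gamma> (p u) u))"

definition has_gflow :: "'a labelled_open_graph \<Rightarrow> bool" where
  "has_gflow \<Gamma> \<longleftrightarrow> (\<forall>u\<in>measured \<Gamma>. planar_label (lab \<Gamma> u)) \<and> has_pauli_flow \<Gamma>"

definition has_extended_causal_flow :: "'a labelled_open_graph \<Rightarrow> bool" where
  "has_extended_causal_flow \<Gamma> \<longleftrightarrow> (\<forall>u\<in>measured \<Gamma>. lab \<Gamma> u \<in> {XY, YZ})
     \<and> (\<exists>f. (\<forall>u\<in>measured \<Gamma>. f u \<in> non_inputs \<Gamma>)
          \<and> strict_partial_order ((flow_rel \<Gamma> (\<lambda>u. {f u}))\<^sup>+)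
          \<and> (\<forall>u\<in>measured \<Gamma>. (lab \<Gamma> u = XY \<longrightarrow> f u \<in> neighbours \<Gamma> u)
                            \<and> (lab \<Gamma> u = YZ \<longrightarrow> f u = u)))"


section \<open>Flows of diagrams\<close>

definition pauli_count :: "'a labelled_open_graph \<Rightarrow> nat" where
  "pauli_count \<Gamma> = card {u \<in> measured \<Gamma>. pauli_label (lab \<Gamma> u)}"

text \<open>The maximiser is unique: the three Pauli types have no effect in common.\<close>

definition diagram_pauli_flow :: "'a diagram \<Rightarrow> bool" where
  "diagram_pauli_flow D \<longleftrightarrow> (\<exists>\<Gamma>. is_arg_max pauli_count (corresponds D) \<Gamma> \<and> has_pauli_flow \<Gamma>)"

definition diagram_gflow :: "'a diagram \<Rightarrow> bool" where
  "diagram_gflow D \<longleftrightarrow> (\<exists>\<Gamma>. corresponds D \<Gamma> \<and> has_gflow \<Gamma>)"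

definition diagram_extended_causal_flow :: "'a diagram \<Rightarrow> bool" where
  "diagram_extended_causal_flow D \<longleftrightarrow> (\<exists>\<Gamma>. corresponds D \<Gamma> \<and> has_extended_causal_flow \<Gamma>)"


section \<open>Redistribution of phases\<close>

definition redistributed ::
  "'a diagram \<Rightarrow> 'a diagram \<Rightarrow> 'a \<Rightarrow> 'a \<Rightarrow> real \<Rightarrow> real \<Rightarrow> real \<Rightarrow> bool" where
  "redistributed D D' v w \<alpha> \<beta> \<alpha>' \<longleftrightarrow>
     verts D' = verts D \<and> edges D' = edges D \<and> inputs D' = inputs D \<and> outputs D' = outputs D
     \<and> (\<forall>u\<in>measured D - {v, w}. same_effect (eff D u) (eff D' u))
     \<and> YZ_measured D' v \<alpha>' \<and> XY_measured D' w (\<alpha> - \<alpha>' + \<beta>)"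

definition pauli_angle :: "real \<Rightarrow> bool" where
  "pauli_angle \<alpha> \<longleftrightarrow> (\<exists>k::int. \<alpha> = of_int k * (pi / 2))"

text \<open>For the two redistributed angles: both effects are Pauli effects (types X, Y or Z). Pauli
  flow is not preserved when a phase is redistributed between a doubly Pauli pair and one that is
  not: on the path with vertices 0, 1, 2 and no inputs or outputs, the labels Z, X, Y have Pauli
  flow, but YZ, XY, Y do not, since then every vertex has a successor in the flow relation.\<close>

definition both_pauli :: "real \<Rightarrow> real \<Rightarrow> bool" where
  "both_pauli \<alpha> \<beta> \<longleftrightarrow> pauli_angle \<alpha> \<and> pauli_angle \<beta>"

end

theory Submission
  imports Defs
begin

text \<open>
  Summing over the pendant vertex \<open>v\<close> turns its \<open>YZ\<close> effect of angle \<open>\<alpha>\<close> into the \<open>XY\<close> effect of the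
  same angle on its neighbour \<open>w\<close>, so only the sum of the two angles enters the linear map.

  For the flows, the order is encoded by a rank function into the natural numbers. As \<open>v\<close> has the
  single neighbour \<open>w\<close>, it lies in the odd neighbourhood of a set iff \<open>w\<close> lies in the set. Unless
  both effects are Pauli, a flow for the labels of \<open>(v, w)\<close> yields one for the labels \<open>(YZ, XY)\<close>: if the
  correction set of \<open>v\<close> or \<open>w\<close> is unsuitable, it is replaced by \<open>{v}\<close>. These labels are available
  for every choice of angles, and specialising them to Pauli labels preserves the flow. If both
  effects are Pauli before and after, the labels either stay the same or are both swapped, and
  toggling \<open>v\<close> in the correction sets containing \<open>w\<close> compensates the swap.
\<close>

section \<open>Flows as rank functions\<close>

text \<open>A rank only has to increase along the generating pairs, which removes transitive
  closures, and a vertex is moved in the order by changing one value.\<close>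

definition ranked_flow :: "'a labelled_open_graph \<Rightarrow> ('a \<Rightarrow> 'a set) \<Rightarrow> ('a \<Rightarrow> nat) \<Rightarrow> bool" where
  "ranked_flow \<Gamma> p r \<longleftrightarrow> (\<forall>u\<in>measured \<Gamma>. p u \<subseteq> non_inputs \<Gamma>)
     \<and> (\<forall>(u, x)\<in>flow_rel \<Gamma> p. r u < r x)
     \<and> (\<forall>u\<in>measured \<Gamma>. correction_condition (lab \<Gamma> u) \<Gamma> (p u) u)"

text \<open>The rank of a vertex is its number of strict predecessors. Along a pair, everything
  below \<open>x\<close> is below \<open>y\<close>, and \<open>x\<close> is below \<open>y\<close>
  but not below itself.\<close>

lemma finite_acyclic_imp_rank:
  assumes "finite R" "acyclic R"
  shows "\<exists>r :: 'a \<Rightarrow> nat. \<forall>(x, y)\<in>R. r x < r y"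
proof (intro exI ballI)
  fix e assume "e \<in> R"
  obtain x y where e: "e = (x, y)" by fastforce
  let ?below = "\<lambda>a. {b. (b, a) \<in> R\<^sup>+}"
  have "finite (?below y)"
    by (rule finite_subset[of _ "Domain R"])
       (auto intro: finite_Domain simp: assms dest: tranclD)
  moreover have "?below x \<subset> ?below y"
    using \<open>e \<in> R\<close> \<open>acyclic R\<close> e by (auto simp: acyclic_def dest: trancl_into_trancl)
  ultimately show "case e of (x, y) \<Rightarrow> card (?below x) < card (?below y)"
    using e by (simp add: psubset_card_mono)
qed

lemma acyclic_if_rank:
  fixes r :: "'a \<Rightarrow> nat"
  assumes "\<forall>(x, y)\<in>R. r x < r y"
  shows "acyclic R"
proof -
  have "r x < r y" if "(x, y) \<in> R\<^sup>+" for x y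
    using that assms by induction (auto intro: less_trans)
  then show ?thesis
    by (auto simp: acyclic_def)
qed

lemma strict_partial_order_trancl_iff:
  assumes "finite R"
  shows "strict_partial_order (R\<^sup>+) \<longleftrightarrow> (\<exists>r :: 'a \<Rightarrow> nat. \<forall>(x, y)\<in>R. r x < r y)"
proof -
  have "strict_partial_order (R\<^sup>+) \<longleftrightarrow> acyclic R"
    by (simp add: strict_partial_order_def irrefl_def acyclic_def)
  then show ?thesis
    using finite_acyclic_imp_rank[OF assms] acyclic_if_rank by blast
qed

lemma finite_flow_rel:
  assumes "open_graph \<Gamma>"
  shows "finite (flow_rel \<Gamma> p)"
  using assms
  by (intro finite_subset[of "flow_rel \<Gamma> p" "verts \<Gamma> \<times> verts \<Gamma>"])
     (auto simp: flow_rel_def open_graph_def measured_def)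

lemma has_pauli_flow_iff_ranked:
  assumes "open_graph \<Gamma>"
  shows "has_pauli_flow \<Gamma> \<longleftrightarrow> (\<exists>p r. ranked_flow \<Gamma> p r)"
  unfolding has_pauli_flow_def ranked_flow_def
  using strict_partial_order_trancl_iff[OF finite_flow_rel[OF assms]] by blast

section \<open>Neighbourhoods in a simple graph\<close>

lemma edge_endpoints:
  assumes "open_graph \<Gamma>" "{x, y} \<in> edges \<Gamma>"
  shows "x \<in> verts \<Gamma>" "y \<in> verts \<Gamma>" "x \<noteq> y"
proof -
  have "{x, y} \<in> {{u, v} | u v. u \<in> verts \<Gamma> \<and> v \<in> verts \<Gamma> \<and> u \<noteq> v}"
    using assms unfolding open_graph_def by blast
  then show "x \<in> verts \<Gamma>" "y \<in> verts \<Gamma>" "x \<noteq> y"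
    by (auto simp: doubleton_eq_iff)
qed

lemma neighbours_sym:
  assumes "open_graph \<Gamma>"
  shows "x \<in> neighbours \<Gamma> y \<longleftrightarrow> y \<in> neighbours \<Gamma> x"
  using edge_endpoints[OF assms, of x y] by (auto simp: neighbours_def insert_commute[of y x])

lemma not_neighbour_self:
  assumes "open_graph \<Gamma>"
  shows "x \<notin> neighbours \<Gamma> x"
  using edge_endpoints[OF assms, of x x] by (auto simp: neighbours_def)

lemma finite_neighbours:
  assumes "open_graph \<Gamma>"
  shows "finite (neighbours \<Gamma> x)"
  using assms by (simp add: neighbours_def open_graph_def)

lemma Odd_singleton:
  assumes "open_graph \<Gamma>"
  shows "Odd \<Gamma> {x} = neighbours \<Gamma> x"
proof -
  have "y \<in> Odd \<Gamma> {x} \<longleftrightarrow> y \<in> neighbours \<Gamma> x" for y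
    using neighbours_sym[OF assms, of x y]
    by (cases "x \<in> neighbours \<Gamma> y") (auto simp: Odd_def, auto simp: neighbours_def)
  then show ?thesis by blast
qed

text \<open>The odd neighbourhood of a singleton is the neighbourhood of its element, and there are
  no loops. So this flow is a Pauli flow with singleton correction sets, and the constructions below
  apply to it.\<close>

lemma has_extended_causal_flow_iff_ranked:
  assumes "open_graph \<Gamma>"
  shows "has_extended_causal_flow \<Gamma> \<longleftrightarrow>
    (\<forall>u\<in>measured \<Gamma>. lab \<Gamma> u \<in> {XY, YZ}) \<and> (\<exists>f r. ranked_flow \<Gamma> (\<lambda>u. {f u}) r)"
proof -
  have corr: "correction_condition (lab \<Gamma> u) \<Gamma> {x} u
      \<longleftrightarrow> (lab \<Gamma> u = XY \<longrightarrow> x \<in> neighbours \<Gamma> u) \<and> (lab \<Gamma> u = YZ \<longrightarrow> x = u)"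
    if "lab \<Gamma> u \<in> {XY, YZ}" for u x
    using that not_neighbour_self[OF assms, of u] neighbours_sym[OF assms, of u x]
    by (auto simp: Odd_singleton[OF assms])
  show ?thesis
  proof (cases "\<forall>u\<in>measured \<Gamma>. lab \<Gamma> u \<in> {XY, YZ}")
    case True
    then have "(\<forall>u\<in>measured \<Gamma>. correction_condition (lab \<Gamma> u) \<Gamma> {f u} u) \<longleftrightarrow>
        (\<forall>u\<in>measured \<Gamma>. (lab \<Gamma> u = XY \<longrightarrow> f u \<in> neighbours \<Gamma> u) \<and> (lab \<Gamma> u = YZ \<longrightarrow> f u = u))" for f
      using corr by blast
    then show ?thesis
      unfolding has_extended_causal_flow_def ranked_flow_def
        strict_partial_order_trancl_iff[OF finite_flow_rel[OF assms]]
      by simp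
  qed (auto simp: has_extended_causal_flow_def)
qed

section \<open>Relabelling and specialisation to Pauli labels\<close>

lemma lab_update_simps [simp]:
  "measured (\<Gamma>\<lparr>lab := f\<rparr>) = measured \<Gamma>" "non_inputs (\<Gamma>\<lparr>lab := f\<rparr>) = non_inputs \<Gamma>"
  "neighbours (\<Gamma>\<lparr>lab := f\<rparr>) = neighbours \<Gamma>" "Odd (\<Gamma>\<lparr>lab := f\<rparr>) = Odd \<Gamma>"
  "Odd_closed (\<Gamma>\<lparr>lab := f\<rparr>) = Odd_closed \<Gamma>" "open_graph (\<Gamma>\<lparr>lab := f\<rparr>) = open_graph \<Gamma>"
  by (auto simp: measured_def non_inputs_def neighbours_def Odd_def Odd_closed_def open_graph_def
      fun_eq_iff)

lemma correction_condition_lab_update [simp]: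
  "correction_condition l (\<Gamma>\<lparr>lab := f\<rparr>) S u = correction_condition l \<Gamma> S u"
  by (cases l) auto

lemma Odd_closed_iff: "x \<in> Odd_closed \<Gamma> S \<longleftrightarrow> (x \<in> S) \<noteq> (x \<in> Odd \<Gamma> S)"
  by (auto simp: Odd_closed_def)

text \<open>A planar label specialises to the two Pauli labels whose axes span its plane.\<close>

fun special_case :: "label \<Rightarrow> label \<Rightarrow> bool" where
  "special_case XY l \<longleftrightarrow> l \<in> {XY, X, Y}"
| "special_case YZ l \<longleftrightarrow> l \<in> {YZ, Y, Z}"
| "special_case XZ l \<longleftrightarrow> l \<in> {XZ, X, Z}"
| "special_case k l \<longleftrightarrow> l = k"

lemma special_case_refl [simp]: "special_case l l"
  by (cases l) auto

text \<open>A planar condition fixes both memberships of \<open>u\<close>, which implies the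
  condition of each Pauli label in the plane. A specialised vertex receives no new pairs, so
  correction sets and ranks are kept.\<close>

lemma ranked_flow_special_case:
  assumes flow: "ranked_flow \<Gamma> p r"
    and lab: "\<And>u. u \<in> measured \<Gamma> \<Longrightarrow> special_case (lab \<Gamma> u) (f u)"
  shows "ranked_flow (\<Gamma>\<lparr>lab := f\<rparr>) p r"
proof -
  have "correction_condition (f u) \<Gamma> (p u) u" if "u \<in> measured \<Gamma>" for u
  proof -
    have "correction_condition (lab \<Gamma> u) \<Gamma> (p u) u"
      using flow that by (simp add: ranked_flow_def)
    then show ?thesis
      using lab[OF that] by (cases "lab \<Gamma> u") (auto simp: Odd_closed_iff)
  qed
  moreover have "flow_rel (\<Gamma>\<lparr>lab := f\<rparr>) p \<subseteq> flow_rel \<Gamma> p"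
  proof (rule subrelI)
    fix u x assume ux: "(u, x) \<in> flow_rel (\<Gamma>\<lparr>lab := f\<rparr>) p"
    then have "x \<in> outputs \<Gamma> \<or> special_case (lab \<Gamma> x) (f x)"
      using lab by (auto simp: flow_rel_def measured_def)
    then show "(u, x) \<in> flow_rel \<Gamma> p"
      using ux by (cases "lab \<Gamma> x"; auto simp: flow_rel_def Odd_closed_iff)
  qed
  ultimately show ?thesis
    using flow by (auto simp: ranked_flow_def)
qed

section \<open>Flow at a pendant vertex\<close>

text \<open>\<open>swap_v\<close> and \<open>swap_w\<close> describe how the Pauli label of a
  \<open>YZ\<close> or an \<open>XY\<close> effect changes when its angle moves by an odd multiple
  of \<pi>/2.\<close>

fun swap_v :: "label \<Rightarrow> label" where
  "swap_v Z = Y" | "swap_v Y = Z" | "swap_v l = l"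

fun swap_w :: "label \<Rightarrow> label" where
  "swap_w X = Y" | "swap_w Y = X" | "swap_w l = l"

text \<open>As \<open>v\<close> is not an input, \<open>{v}\<close> is an admissible correction set,
  and \<open>v\<close> may be inserted into any other one.\<close>

locale pendant =
  fixes \<Gamma> :: "'a labelled_open_graph" and v w :: 'a
  assumes graph: "open_graph \<Gamma>"
    and v: "v \<in> measured \<Gamma>" "v \<notin> inputs \<Gamma>"
    and nbr: "neighbours \<Gamma> v = {w}"
    and w: "w \<in> measured \<Gamma>"
begin

lemma distinct [simp]: "v \<noteq> w" "w \<noteq> v"
  using not_neighbour_self[OF graph, of v] nbr by auto

lemma verts [simp]: "v \<in> verts \<Gamma>" "w \<in> verts \<Gamma>" "v \<notin> outputs \<Gamma>" "w \<notin> outputs \<Gamma>"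
  using v w by (auto simp: measured_def)

lemma v_non_input [simp]: "v \<in> non_inputs \<Gamma>"
  using v by (simp add: non_inputs_def)

lemma nbr_v_iff: "v \<in> neighbours \<Gamma> x \<longleftrightarrow> x = w"
  using neighbours_sym[OF graph, of v x] nbr by simp

lemma v_in_Odd [simp]: "v \<in> Odd \<Gamma> S \<longleftrightarrow> w \<in> S"
  by (cases "w \<in> S") (auto simp: Odd_def nbr)

lemma Odd_v [simp]: "Odd \<Gamma> {v} = {w}"
  by (simp add: Odd_singleton[OF graph] nbr)

text \<open>If \<open>w\<close> precedes \<open>v\<close> or has the same rank, the flow already satisfies the new conditions.
  Otherwise \<open>v\<close> is corrected by itself and moved to a position just before \<open>w\<close>, so the ranks are
  doubled to make room.\<close>

lemma ranked_flow_v_YZ: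
  assumes flow: "ranked_flow \<Gamma> p r" and labels: "lab \<Gamma> w = XY" "lab \<Gamma> v \<noteq> X"
  shows "\<exists>p' r'. ranked_flow (\<Gamma>\<lparr>lab := (lab \<Gamma>)(v := YZ)\<rparr>) p' r' \<and> (\<forall>u. p' u = p u \<or> p' u = {v})"
proof -
  have sub: "p u \<subseteq> non_inputs \<Gamma>" and corr: "correction_condition (lab \<Gamma> u) \<Gamma> (p u) u"
    if "u \<in> measured \<Gamma>" for u
    using flow that by (auto simp: ranked_flow_def)
  have less: "r u < r x" if "(u, x) \<in> flow_rel \<Gamma> p" for u x
    using flow that by (auto simp: ranked_flow_def)
  have to_w: "r u < r w" if "u \<in> measured \<Gamma>" "u \<noteq> w" "w \<in> p u \<or> w \<in> Odd \<Gamma> (p u)" for u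
    using that labels by (intro less) (auto simp: flow_rel_def)
  \<comment> \<open>As \<open>w \<notin> p u\<close> keeps \<open>v\<close> out of the odd
    neighbourhood, \<open>v \<in> p u\<close> gives a pair into \<open>v\<close> for every label
    except \<open>X\<close>; for \<open>Y\<close>, exactly one membership holds.\<close>
  have to_v: "r u < r v" if "u \<in> measured \<Gamma>" "u \<noteq> v" "v \<in> p u" "w \<notin> p u" for u
    using that labels
    by (intro less) (simp add: flow_rel_def Odd_closed_iff)
  have pw: "w \<notin> p w"
    using corr[OF w] labels by simp
  have pv: "v \<in> p v \<or> w \<in> p v"
    using corr[OF v(1)] labels by (cases "lab \<Gamma> v") (auto simp: Odd_closed_iff)
  show ?thesis
  proof (cases "r w \<le> r v")
    case True
    \<comment> \<open>Membership of \<open>w\<close> in \<open>p v\<close> would give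
      \<open>r v < r w\<close>. Hence \<open>v \<in> p v\<close>, and the old set satisfies the
      \<open>YZ\<close> condition.\<close>
    then have "w \<notin> p v" using to_w[OF v(1)] by auto
    have "r u < r x" if ux: "(u, x) \<in> flow_rel (\<Gamma>\<lparr>lab := (lab \<Gamma>)(v := YZ)\<rparr>) p" for u x
    proof (cases "x = v")
      case xv: True
      then have u: "u \<in> measured \<Gamma>" "u \<noteq> v" "v \<in> p u \<or> w \<in> p u"
        using ux by (auto simp: flow_rel_def)
      show ?thesis
      proof (cases "w \<in> p u")
        case wu: True
        then have "r u < r w" using to_w u pw by metis
        with xv True show ?thesis by simp
      qed (use xv u to_v in blast)
    qed (use ux less in \<open>auto simp: flow_rel_def\<close>)
    then have "ranked_flow (\<Gamma>\<lparr>lab := (lab \<Gamma>)(v := YZ)\<rparr>) p r"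
      using sub corr pv \<open>w \<notin> p v\<close> by (auto simp: ranked_flow_def)
    then show ?thesis by blast
  next
    case False
    \<comment> \<open>The value \<open>2 * r w\<close> is one less than the new rank of
      \<open>w\<close> and exceeds \<open>2 * r u + 1\<close> whenever
      \<open>r u < r w\<close>.\<close>
    define r' where "r' x = (if x = v then 2 * r w else 2 * r x + 1)" for x
    have "r' u < r' x" if ux: "(u, x) \<in> flow_rel (\<Gamma>\<lparr>lab := (lab \<Gamma>)(v := YZ)\<rparr>) (p(v := {v}))" for u x
    proof (cases "u = v")
      case True
      \<comment> \<open>The odd neighbourhood of \<open>{v}\<close> is \<open>{w}\<close>, so the
        only pair out of \<open>v\<close> leads to \<open>w\<close>.\<close>
      then show ?thesis using ux by (auto simp: flow_rel_def r'_def Odd_closed_iff)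
    next
      case uv: False
      then have u: "u \<in> measured \<Gamma>"
        using ux by (auto simp: flow_rel_def)
      show ?thesis
      proof (cases "x = v")
        case True
        then have "v \<in> p u \<or> w \<in> p u" using uv ux by (auto simp: flow_rel_def)
        \<comment> \<open>Either \<open>w \<in> p u\<close> and \<open>to_w\<close> applies, or
          \<open>v \<in> p u\<close> and \<open>r u < r v < r w\<close>.\<close>
        then have "r u < r w"
          by (metis False linorder_not_less nless_le order_less_trans pw to_v to_w u uv)
        then show ?thesis using True uv by (simp add: r'_def)
      next
        case xv: False
        then have "r u < r x"
          using ux uv by (intro less) (auto simp: flow_rel_def)
        then show ?thesis using xv uv by (simp add: r'_def)
      qed
    qed
    then have "ranked_flow (\<Gamma>\<lparr>lab := (lab \<Gamma>)(v := YZ)\<rparr>) (p(v := {v})) r'"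
      using sub corr by (auto simp: ranked_flow_def)
    then show ?thesis by (metis fun_upd_apply)
  qed
qed

text \<open>As above with \<open>v\<close> and \<open>w\<close> exchanged: \<open>{v}\<close> also corrects \<open>w\<close>, since its odd neighbourhood is
  \<open>{w}\<close>.\<close>

lemma ranked_flow_w_XY:
  assumes flow: "ranked_flow \<Gamma> p r" and labels: "lab \<Gamma> v = YZ" "lab \<Gamma> w \<noteq> Z"
  shows "\<exists>p' r'. ranked_flow (\<Gamma>\<lparr>lab := (lab \<Gamma>)(w := XY)\<rparr>) p' r' \<and> (\<forall>u. p' u = p u \<or> p' u = {v})"
proof -
  have sub: "p u \<subseteq> non_inputs \<Gamma>" and corr: "correction_condition (lab \<Gamma> u) \<Gamma> (p u) u"
    if "u \<in> measured \<Gamma>" for u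
    using flow that by (auto simp: ranked_flow_def)
  have less: "r u < r x" if "(u, x) \<in> flow_rel \<Gamma> p" for u x
    using flow that by (auto simp: ranked_flow_def)
  have to_v: "r u < r v" if "u \<in> measured \<Gamma>" "u \<noteq> v" "v \<in> p u \<or> w \<in> p u" for u
    using that labels by (intro less) (auto simp: flow_rel_def)
  \<comment> \<open>For \<open>w \<notin> p u\<close>, lying in the odd neighbourhood gives a pair
    into \<open>w\<close> for every label except \<open>Z\<close>.\<close>
  have to_w: "r u < r w" if "u \<in> measured \<Gamma>" "u \<noteq> w" "w \<in> Odd \<Gamma> (p u)" "w \<notin> p u" for u
    using that labels
    by (intro less) (simp add: flow_rel_def Odd_closed_iff)
  have pv: "v \<in> p v" "w \<notin> p v"
    using corr[OF v(1)] labels by simp_all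
  have pw: "w \<in> p w \<or> w \<in> Odd \<Gamma> (p w)"
    using corr[OF w] labels by (cases "lab \<Gamma> w") (auto simp: Odd_closed_iff)
  show ?thesis
  proof (cases "r v \<le> r w")
    case True
    \<comment> \<open>Membership of \<open>w\<close> in \<open>p w\<close> would put
      \<open>v\<close> into the odd neighbourhood of \<open>p w\<close> and give
      \<open>r w < r v\<close>.\<close>
    then have "w \<notin> p w" using to_v[OF w] by auto
    have "r u < r x" if ux: "(u, x) \<in> flow_rel (\<Gamma>\<lparr>lab := (lab \<Gamma>)(w := XY)\<rparr>) p" for u x
    proof (cases "x = w")
      case xw: True
      then have u: "u \<in> measured \<Gamma>" "u \<noteq> w" "w \<in> p u \<or> w \<in> Odd \<Gamma> (p u)"
        using ux by (auto simp: flow_rel_def)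
      show ?thesis
      proof (cases "w \<in> p u")
        case wu: True
        then have "r u < r v" using to_v u pv by metis
        with xw True show ?thesis by simp
      qed (use xw u to_w in blast)
    qed (use ux less in \<open>auto simp: flow_rel_def\<close>)
    then have "ranked_flow (\<Gamma>\<lparr>lab := (lab \<Gamma>)(w := XY)\<rparr>) p r"
      using sub corr pw \<open>w \<notin> p w\<close> by (auto simp: ranked_flow_def)
    then show ?thesis by blast
  next
    case False
    define r' where "r' x = (if x = w then 2 * r v else 2 * r x + 1)" for x
    have "r' u < r' x" if ux: "(u, x) \<in> flow_rel (\<Gamma>\<lparr>lab := (lab \<Gamma>)(w := XY)\<rparr>) (p(w := {v}))" for u x
    proof (cases "u = w")
      case True
      then show ?thesis using ux by (auto simp: flow_rel_def r'_def Odd_closed_iff)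
    next
      case uw: False
      then have u: "u \<in> measured \<Gamma>"
        using ux by (auto simp: flow_rel_def)
      show ?thesis
      proof (cases "x = w")
        case True
        then have "w \<in> p u \<or> w \<in> Odd \<Gamma> (p u)" using uw ux by (auto simp: flow_rel_def)
        then have "r u < r v"
          by (metis False linorder_not_less nless_le order_less_trans pv(2) to_v to_w u uw)
        then show ?thesis using True uw by (simp add: r'_def)
      next
        case xw: False
        then have "r u < r x"
          using ux uw by (intro less) (auto simp: flow_rel_def)
        then show ?thesis using xw uw by (simp add: r'_def)
      qed
    qed
    then have "ranked_flow (\<Gamma>\<lparr>lab := (lab \<Gamma>)(w := XY)\<rparr>) (p(w := {v})) r'"
      using sub corr by (auto simp: ranked_flow_def)
    then show ?thesis by (metis fun_upd_apply)
  qed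
qed

text \<open>Whichever vertex already has its target label, the other one is relabelled. The last
  conjunct serves extended causal flow: singletons stay singletons.\<close>

lemma ranked_flow_YZ_XY:
  assumes flow: "ranked_flow \<Gamma> p r"
    and labels: "(lab \<Gamma> w = XY \<and> lab \<Gamma> v \<noteq> X) \<or> (lab \<Gamma> v = YZ \<and> lab \<Gamma> w \<noteq> Z)"
  shows "\<exists>p' r'. ranked_flow (\<Gamma>\<lparr>lab := (lab \<Gamma>)(v := YZ, w := XY)\<rparr>) p' r'
    \<and> (\<forall>u. p' u = p u \<or> p' u = {v})"
  using labels
proof
  assume l: "lab \<Gamma> w = XY \<and> lab \<Gamma> v \<noteq> X"
  then have "(lab \<Gamma>)(v := YZ, w := XY) = (lab \<Gamma>)(v := YZ)" by auto
  then show ?thesis using ranked_flow_v_YZ[OF flow] l by simp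
next
  assume l: "lab \<Gamma> v = YZ \<and> lab \<Gamma> w \<noteq> Z"
  then have "(lab \<Gamma>)(v := YZ, w := XY) = (lab \<Gamma>)(w := XY)" by auto
  then show ?thesis using ranked_flow_w_XY[OF flow] l by simp
qed

text \<open>Any other planar label of \<open>v\<close> forces \<open>w \<in> p v\<close>; any other
  planar label of \<open>w\<close> forces \<open>w \<in> p w\<close>, which puts \<open>v\<close>
  into the odd neighbourhood of \<open>p w\<close>. With both, \<open>v\<close> and \<open>w\<close>
  would precede each other.\<close>

lemma planar_flow_labels:
  assumes flow: "ranked_flow \<Gamma> p r" and labels: "planar_label (lab \<Gamma> v)" "planar_label (lab \<Gamma> w)"
  shows "lab \<Gamma> w = XY \<or> lab \<Gamma> v = YZ"
proof (rule ccontr)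
  assume neg: "\<not> ?thesis"
  have corr: "correction_condition (lab \<Gamma> v) \<Gamma> (p v) v" "correction_condition (lab \<Gamma> w) \<Gamma> (p w) w"
    using flow v w by (auto simp: ranked_flow_def)
  then have "w \<in> p v" "w \<in> p w"
    using labels neg by (auto simp: planar_label_def)
  then have "(v, w) \<in> flow_rel \<Gamma> p" "(w, v) \<in> flow_rel \<Gamma> p"
    using labels v w by (auto simp: flow_rel_def planar_label_def)
  then have "r v < r w" "r w < r v"
    using flow by (auto simp: ranked_flow_def)
  then show False by simp
qed

text \<open>Toggling \<open>v\<close> in a correction set toggles \<open>w\<close> in its odd neighbourhood and nothing else. Doing so
  whenever \<open>w\<close> belongs to the set turns the conditions for the labels \<open>(Z, X)\<close> and \<open>(Z, Y)\<close> of
  \<open>(v, w)\<close> into those for \<open>(Y, Y)\<close> and \<open>(Y, X)\<close>.\<close>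

definition toggle :: "'a set \<Rightarrow> 'a set" where
  "toggle S = (if w \<in> S then S - {v} \<union> ({v} - S) else S)"

lemma toggle_other: "x \<noteq> v \<Longrightarrow> x \<in> toggle S \<longleftrightarrow> x \<in> S"
  by (auto simp: toggle_def)

lemma v_in_toggle: "v \<in> toggle S \<longleftrightarrow> (v \<in> S) \<noteq> (w \<in> S)"
  by (auto simp: toggle_def)

lemma Odd_toggle_other:
  assumes "x \<noteq> w"
  shows "x \<in> Odd \<Gamma> (toggle S) \<longleftrightarrow> x \<in> Odd \<Gamma> S"
proof -
  have "neighbours \<Gamma> x \<inter> toggle S = neighbours \<Gamma> x \<inter> S"
    using assms nbr_v_iff[of x] by (auto simp: toggle_def)
  then show ?thesis by (simp add: Odd_def)
qed

lemma w_in_Odd_toggle: "w \<in> Odd \<Gamma> (toggle S) \<longleftrightarrow> (w \<in> Odd \<Gamma> S) \<noteq> (w \<in> S)"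
proof (cases "w \<in> S")
  case True
  let ?N = "neighbours \<Gamma> w"
  have fin: "finite (?N \<inter> S - {v})"
    using finite_neighbours[OF graph] by simp
  have vN: "v \<in> ?N" by (simp add: nbr_v_iff)
  show ?thesis
  proof (cases "v \<in> S")
    case vS: True
    then have "?N \<inter> S = insert v (?N \<inter> S - {v})" "?N \<inter> toggle S = ?N \<inter> S - {v}"
      using True vN by (auto simp: toggle_def)
    then have "card (?N \<inter> S) = Suc (card (?N \<inter> toggle S))"
      using fin by (metis Diff_iff card_insert_disjoint insertCI)
    then show ?thesis using True by (simp add: Odd_def)
  next
    case False
    then have "?N \<inter> toggle S = insert v (?N \<inter> S - {v})" "?N \<inter> S = ?N \<inter> S - {v}"
      using True vN by (auto simp: toggle_def)
    then have "card (?N \<inter> toggle S) = Suc (card (?N \<inter> S))"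
      using fin by (metis Diff_iff card_insert_disjoint insertCI)
    then show ?thesis using True by (simp add: Odd_def)
  qed
qed (simp add: toggle_def)

text \<open>At \<open>v\<close>, passing from \<open>S\<close> to \<open>toggle S\<close> exchanges
  membership with membership in the closed odd neighbourhood; at \<open>w\<close> it exchanges the
  odd and the closed odd neighbourhood. Every new condition and pair thus comes from an old one, and
  the ranks are kept.\<close>

lemma ranked_flow_swap:
  assumes flow: "ranked_flow \<Gamma> p r" and labels: "lab \<Gamma> v \<in> {Y, Z}" "lab \<Gamma> w \<in> {X, Y}"
  shows "ranked_flow (\<Gamma>\<lparr>lab := (lab \<Gamma>)(v := swap_v (lab \<Gamma> v), w := swap_w (lab \<Gamma> w))\<rparr>) (toggle \<circ> p) r"
    (is "ranked_flow (\<Gamma>\<lparr>lab := ?f\<rparr>) _ _")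
proof -
  have "flow_rel (\<Gamma>\<lparr>lab := ?f\<rparr>) (toggle \<circ> p) \<subseteq> flow_rel \<Gamma> p"
  proof (rule subrelI)
    fix u x assume ux: "(u, x) \<in> flow_rel (\<Gamma>\<lparr>lab := ?f\<rparr>) (toggle \<circ> p)"
    consider "x = v" | "x = w" | "x \<noteq> v" "x \<noteq> w" by blast
    then show "(u, x) \<in> flow_rel \<Gamma> p"
    proof cases
      case 1
      with ux labels show ?thesis
        by (auto simp: flow_rel_def Odd_closed_iff v_in_toggle toggle_other)
    next
      case 2
      with ux labels show ?thesis
        by (auto simp: flow_rel_def Odd_closed_iff w_in_Odd_toggle toggle_other)
    next
      case 3
      with ux show ?thesis
        by (simp add: flow_rel_def Odd_closed_iff Odd_toggle_other toggle_other)
    qed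
  qed
  moreover have "correction_condition (?f u) \<Gamma> (toggle (p u)) u" if "u \<in> measured \<Gamma>" for u
  proof -
    have corr: "correction_condition (lab \<Gamma> u) \<Gamma> (p u) u"
      using flow that by (simp add: ranked_flow_def)
    consider "u = v" | "u = w" | "u \<noteq> v" "u \<noteq> w" by blast
    then show ?thesis
    proof cases
      case 1
      with corr labels show ?thesis
        by (auto simp: Odd_closed_iff v_in_toggle toggle_other)
    next
      case 2
      with corr labels show ?thesis
        by (auto simp: Odd_closed_iff w_in_Odd_toggle toggle_other)
    next
      case 3
      with corr show ?thesis
        by (cases "lab \<Gamma> u") (simp_all add: Odd_closed_iff Odd_toggle_other toggle_other)
    qed
  qed
  \<comment> \<open>Only \<open>v\<close> can be added, and it is not an input.\<close>
  moreover have "toggle S \<subseteq> insert v S" for S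
    by (auto simp: toggle_def)
  ultimately show ?thesis
    using flow unfolding ranked_flow_def by fastforce
qed

end

section \<open>Types of effects\<close>

lemma same_effect_sym: "same_effect e e' \<Longrightarrow> same_effect e' e"
proof -
  assume "same_effect e e'"
  then obtain c where "c \<noteq> 0" "\<forall>b. e' b = c * e b" by (auto simp: same_effect_def)
  then show ?thesis unfolding same_effect_def by (intro exI[of _ "inverse c"]) simp
qed

lemma same_effect_trans: "same_effect e e' \<Longrightarrow> same_effect e' e'' \<Longrightarrow> same_effect e e''"
  unfolding same_effect_def by (metis mult.assoc mult_eq_0_iff)

lemma effect_of_type_cong:
  assumes "same_effect e e'"
  shows "effect_of_type l e \<longleftrightarrow> effect_of_type l e'"
proof -
  have "same_effect e f \<longleftrightarrow> same_effect e' f" for f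
    using assms same_effect_sym same_effect_trans by blast
  then show ?thesis by (cases l) simp_all
qed

lemma same_effectD: "same_effect e e' \<Longrightarrow> \<exists>c. c \<noteq> 0 \<and> (\<forall>b. e b = c * e' b)"
  using same_effect_sym unfolding same_effect_def by blast

text \<open>The Bloch vector, unnormalised: \<open>x\<close> and \<open>y\<close> are at half the scale of \<open>z\<close>. Only the
  vanishing of coordinates matters below.\<close>

definition bloch_x :: "effect \<Rightarrow> real" where
  "bloch_x e = Re (cnj (e False) * e True)"

definition bloch_y :: "effect \<Rightarrow> real" where
  "bloch_y e = Im (cnj (e False) * e True)"

definition bloch_z :: "effect \<Rightarrow> real" where
  "bloch_z e = (cmod (e False))\<^sup>2 - (cmod (e True))\<^sup>2"

text \<open>A scalar \<open>c\<close> enters each coordinate as \<open>c * cnj c\<close>, which is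
  positive.\<close>

lemma bloch_scale:
  assumes "same_effect e e'"
  shows "\<exists>k>0. bloch_x e = k * bloch_x e' \<and> bloch_y e = k * bloch_y e' \<and> bloch_z e = k * bloch_z e'"
proof -
  obtain c where c: "c \<noteq> 0" "\<And>b. e b = c * e' b"
    using same_effectD[OF assms] by blast
  have "cnj (e False) * e True = (c * cnj c) * (cnj (e' False) * e' True)"
    by (simp add: c(2))
  then have "cnj (e False) * e True = complex_of_real ((cmod c)\<^sup>2) * (cnj (e' False) * e' True)"
    by (simp only: complex_norm_square)
  then have "bloch_x e = (cmod c)\<^sup>2 * bloch_x e'" "bloch_y e = (cmod c)\<^sup>2 * bloch_y e'"
    by (simp_all only: bloch_x_def bloch_y_def Re_complex_of_real Im_complex_of_real times_complex.sel
        mult_zero_left diff_zero add_0_right)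
  moreover have "bloch_z e = (cmod c)\<^sup>2 * bloch_z e'"
    by (simp add: bloch_z_def c(2) norm_mult power_mult_distrib algebra_simps)
  ultimately show ?thesis using c(1) by (intro exI[of _ "(cmod c)\<^sup>2"]) simp
qed

lemma bloch_xy: "bloch_x (xy_effect \<alpha>) = cos \<alpha>" "bloch_y (xy_effect \<alpha>) = sin \<alpha>" "bloch_z (xy_effect \<alpha>) = 0"
  by (simp_all add: bloch_x_def bloch_y_def bloch_z_def xy_effect_def bra0_def bra1_def)

lemma yz_effect_values:
  "yz_effect \<alpha> False = (1 + cis \<alpha>) / complex_of_real (sqrt 2)"
  "yz_effect \<alpha> True = (1 - cis \<alpha>) / complex_of_real (sqrt 2)"
  by (simp_all add: yz_effect_def bra_plus_def bra_minus_def bra0_def bra1_def add_divide_distrib diff_divide_distrib)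

lemma xz_effect_values:
  "xz_effect \<alpha> False = yz_effect \<alpha> False"
  "xz_effect \<alpha> True = yz_effect \<alpha> True * \<i>"
  by (simp_all add: yz_effect_def xz_effect_def)

lemma bloch_yz: "bloch_x (yz_effect \<alpha>) = 0" "bloch_y (yz_effect \<alpha>) = - sin \<alpha>" "bloch_z (yz_effect \<alpha>) = 2 * cos \<alpha>"
proof -
  show "bloch_x (yz_effect \<alpha>) = 0" "bloch_y (yz_effect \<alpha>) = - sin \<alpha>"
    by (simp_all add: bloch_x_def bloch_y_def yz_effect_values algebra_simps sin_cos_squared_add3
        flip: add_divide_distrib diff_divide_distrib)
  have "(cmod (1 + cis \<alpha>))\<^sup>2 - (cmod (1 - cis \<alpha>))\<^sup>2 = 4 * cos \<alpha>"
    by (simp only: cmod_power2) (simp add: power2_eq_square algebra_simps)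
  then show "bloch_z (yz_effect \<alpha>) = 2 * cos \<alpha>"
    by (simp add: bloch_z_def yz_effect_values norm_divide power_divide flip: diff_divide_distrib)
qed

lemma bloch_xz: "bloch_x (xz_effect \<alpha>) = sin \<alpha>" "bloch_y (xz_effect \<alpha>) = 0" "bloch_z (xz_effect \<alpha>) = 2 * cos \<alpha>"
  using bloch_yz[of \<alpha>]
  by (simp_all add: bloch_x_def bloch_y_def bloch_z_def xz_effect_values norm_mult)

text \<open>A planar label makes the coordinate orthogonal to its plane vanish; a Pauli label lies
  in two planes and makes two coordinates vanish.\<close>

lemma effect_of_type_bloch:
  assumes "effect_of_type l e"
  shows "l \<in> {XY, X, Y} \<Longrightarrow> bloch_z e = 0" "l \<in> {XZ, X, Z} \<Longrightarrow> bloch_y e = 0"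
    "l \<in> {YZ, Y, Z} \<Longrightarrow> bloch_x e = 0"
  using assms by (auto dest!: bloch_scale simp: bloch_xy bloch_xz bloch_yz)

text \<open>The \<open>y\<close> and \<open>z\<close> coordinates are proportional to
  \<open>- sin \<alpha>\<close> and \<open>2 * cos \<alpha>\<close>. Every type other than
  \<open>YZ\<close> makes one of them vanish, and \<open>X\<close> would make both vanish.\<close>

lemma same_effect_yz_type:
  assumes "same_effect e (yz_effect \<alpha>)" "effect_of_type l e"
  shows "l \<noteq> X" "l \<in> {XY, Y} \<Longrightarrow> cos \<alpha> = 0" "l \<in> {XZ, Z} \<Longrightarrow> sin \<alpha> = 0"
proof -
  obtain k where k: "k > 0" "bloch_y e = k * - sin \<alpha>" "bloch_z e = k * (2 * cos \<alpha>)"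
    using bloch_scale[OF assms(1)] by (auto simp: bloch_yz)
  show "l \<in> {XY, Y} \<Longrightarrow> cos \<alpha> = 0" "l \<in> {XZ, Z} \<Longrightarrow> sin \<alpha> = 0"
    using effect_of_type_bloch[OF assms(2)] k by auto
  show "l \<noteq> X"
    using effect_of_type_bloch[OF assms(2)] k sin_zero_norm_cos_one[of \<alpha>] by auto
qed

lemma same_effect_xy_type:
  assumes "same_effect e (xy_effect \<alpha>)" "effect_of_type l e"
  shows "l \<noteq> Z" "l \<in> {YZ, Y} \<Longrightarrow> cos \<alpha> = 0" "l \<in> {XZ, X} \<Longrightarrow> sin \<alpha> = 0"
proof -
  obtain k where k: "k > 0" "bloch_x e = k * cos \<alpha>" "bloch_y e = k * sin \<alpha>"
    using bloch_scale[OF assms(1)] by (auto simp: bloch_xy)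
  show "l \<in> {YZ, Y} \<Longrightarrow> cos \<alpha> = 0" "l \<in> {XZ, X} \<Longrightarrow> sin \<alpha> = 0"
    using effect_of_type_bloch[OF assms(2)] k by auto
  show "l \<noteq> Z"
    using effect_of_type_bloch[OF assms(2)] k sin_zero_norm_cos_one[of \<alpha>] by auto
qed

text \<open>Pauli types admit only standard angles, whereas an effect determines its angle only
  modulo 2\<pi>.\<close>

lemma cis_sin_zero:
  assumes "sin \<alpha> = 0"
  obtains \<gamma> where "\<gamma> \<in> {0, pi}" "cis \<alpha> = cis \<gamma>"
proof -
  have "cos \<alpha> = 1 \<or> cos \<alpha> = -1"
    using sin_zero_norm_cos_one[OF assms] by auto
  then show ?thesis
    using that[of 0] that[of pi] assms by (auto simp: complex_eq_iff)
qed

lemma cis_cos_zero: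
  assumes "cos \<alpha> = 0"
  obtains \<gamma> where "\<gamma> \<in> {pi / 2, - (pi / 2)}" "cis \<alpha> = cis \<gamma>"
proof -
  have "sin \<alpha> = 1 \<or> sin \<alpha> = -1"
    using assms sin_cos_squared_add[of \<alpha>] by (simp add: power2_eq_1_iff)
  then show ?thesis
    using that[of "pi/2"] that[of "-(pi/2)"] assms by (auto simp: complex_eq_iff)
qed

lemma xy_effect_Pauli:
  assumes "same_effect e (xy_effect \<alpha>)"
  shows "sin \<alpha> = 0 \<Longrightarrow> effect_of_type X e" "cos \<alpha> = 0 \<Longrightarrow> effect_of_type Y e"
proof -
  have eq: "same_effect e (xy_effect \<gamma>)" if "cis \<alpha> = cis \<gamma>" for \<gamma>
    using assms that by (simp add: same_effect_def xy_effect_def)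
  show "sin \<alpha> = 0 \<Longrightarrow> effect_of_type X e" "cos \<alpha> = 0 \<Longrightarrow> effect_of_type Y e"
    by (auto elim!: cis_sin_zero cis_cos_zero dest: eq)
qed

text \<open>Type \<open>Y\<close> refers to \<open>XY\<close> effects, so in that case the
  \<open>YZ\<close> effect is compared with the \<open>XY\<close> effect of the opposite
  angle.\<close>

lemma yz_effect_Pauli:
  assumes "same_effect e (yz_effect \<alpha>)"
  shows "sin \<alpha> = 0 \<Longrightarrow> effect_of_type Z e" "cos \<alpha> = 0 \<Longrightarrow> effect_of_type Y e"
proof -
  have eq: "same_effect e (yz_effect \<gamma>)" if "cis \<alpha> = cis \<gamma>" for \<gamma>
    using assms that by (simp add: same_effect_def yz_effect_def)
  show "sin \<alpha> = 0 \<Longrightarrow> effect_of_type Z e"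
    by (auto elim!: cis_sin_zero dest: eq)
  assume "cos \<alpha> = 0"
  then obtain \<gamma> where \<gamma>: "\<gamma> \<in> {pi / 2, - (pi / 2)}" "cis \<alpha> = cis \<gamma>"
    by (rule cis_cos_zero)
  define c where "c = cis \<gamma>"
  have c: "c * c = -1" "cis (- \<gamma>) = - c"
    using \<gamma>(1) unfolding c_def by (elim insertE emptyE; hypsubst; simp)+
  then have "1 + c \<noteq> 0"
    by (metis add_eq_0_iff mult_minus1 minus_minus one_neq_neg_one)
  have "complex_of_real (sqrt 2) \<noteq> 0" by simp
  \<comment> \<open>The factor normalises the entry at \<open>False\<close> to 1. The other entry
    becomes \<open>(1 - c) / (1 + c)\<close>, which is \<open>- c\<close> because
    \<open>c * c = -1\<close>.\<close>
  have "xy_effect (- \<gamma>) b = complex_of_real (sqrt 2) / (1 + c) * yz_effect \<gamma> b" for b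
  proof -
    have "- c * (1 + c) = 1 - c"
      by (simp add: algebra_simps c(1))
    then have "- c = (1 - c) / (1 + c)"
      using \<open>1 + c \<noteq> 0\<close> by (metis nonzero_mult_div_cancel_right)
    then show ?thesis
      using \<open>1 + c \<noteq> 0\<close>
      by (cases b) (simp_all add: yz_effect_values xy_effect_def bra0_def bra1_def c(2) flip: c_def)
  qed
  moreover have "complex_of_real (sqrt 2) / (1 + c) \<noteq> 0"
    using \<open>1 + c \<noteq> 0\<close> by simp
  ultimately have "same_effect (yz_effect \<gamma>) (xy_effect (- \<gamma>))"
    unfolding same_effect_def by blast
  then have "same_effect e (xy_effect (- \<gamma>))"
    using eq[OF \<gamma>(2)] by (rule same_effect_trans[rotated])
  moreover have "- \<gamma> \<in> {pi / 2, - (pi / 2)}"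
    using \<gamma>(1) by (elim insertE emptyE; hypsubst; simp)
  ultimately show "effect_of_type Y e"
    unfolding effect_of_type.simps by blast
qed

text \<open>Multiples of \<pi>/2 are the zeros of sin (2\<alpha>) = 2 sin \<alpha> cos
  \<alpha>.\<close>

lemma pauli_angle_iff: "pauli_angle \<alpha> \<longleftrightarrow> sin \<alpha> = 0 \<or> cos \<alpha> = 0"
proof -
  have "pauli_angle \<alpha> \<longleftrightarrow> sin (2 * \<alpha>) = 0"
    by (simp add: pauli_angle_def sin_zero_iff_int2 field_simps)
  then show ?thesis by (simp add: sin_double)
qed

section \<open>The linear map\<close>

text \<open>The involution reindexes the sum; counting every pair twice avoids a choice of
  representatives.\<close>

lemma sum_pair:
  assumes "finite A" "\<And>y. y \<in> A \<Longrightarrow> h y \<in> A" "\<And>y. y \<in> A \<Longrightarrow> h (h y) = y"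
  shows "2 * (\<Sum>y\<in>A. f y :: complex) = (\<Sum>y\<in>A. f y + f (h y))"
proof -
  have "(\<Sum>y\<in>A. f (h y)) = (\<Sum>y\<in>A. f y)"
    by (rule sum.reindex_bij_witness[of _ h h]) (auto simp: assms)
  then show ?thesis by (simp add: sum.distrib)
qed

text \<open>The sign is the phase of the edge between the two vertices. The bracket is
  \<open>sqrt 2\<close> times 1 or \<open>cis \<alpha>\<close> according to \<open>t\<close>, and
  multiplies the matching entry of the \<open>XY\<close> effect.\<close>

lemma yz_xy_contract:
  "xy_effect \<beta> t * (yz_effect \<alpha> False + (if t then -1 else 1) * yz_effect \<alpha> True)
    = complex_of_real (sqrt 2) * xy_effect (\<alpha> + \<beta>) t"
proof -
  have "complex_of_real (sqrt 2) * complex_of_real (sqrt 2) = 2"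
    by (simp flip: of_real_mult)
  then show ?thesis
    by (cases t) (simp_all add: yz_effect_values xy_effect_def bra0_def bra1_def cis_mult[symmetric]
       field_simps)
qed

text \<open>The only edge at \<open>v\<close> is \<open>{v, w}\<close>, so the dependence on the bit
  of \<open>v\<close> can be split off.\<close>

lemma edge_count:
  assumes graph: "open_graph D" and nbr: "neighbours D v = {w}"
  shows "card {e \<in> edges D. \<forall>u\<in>e. (y(v := b)) u}
    = card {e \<in> edges D. v \<notin> e \<and> (\<forall>u\<in>e. y u)} + (if b \<and> y w then 1 else 0)"
proof -
  have E: "edges D \<subseteq> {{u, v} | u v. u \<in> verts D \<and> v \<in> verts D \<and> u \<noteq> v}"
    using graph by (simp add: open_graph_def)
  have fin: "finite (edges D)"
    by (rule finite_subset[of _ "Pow (verts D)"]) (use E graph in \<open>auto simp: open_graph_def\<close>)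
  have vw: "{v, w} \<in> edges D"
    using nbr by (auto simp: neighbours_def insert_commute)
  have "w \<noteq> v"
    using edge_endpoints[OF graph vw] by simp
  have at_v: "e = {v, w}" if "e \<in> edges D" "v \<in> e" for e
  proof -
    have "e \<in> {{u, v} | u v. u \<in> verts D \<and> v \<in> verts D \<and> u \<noteq> v}"
      using E that(1) by blast
    then obtain x where "e = {x, v}" "x \<in> verts D" using \<open>v \<in> e\<close> by blast
    then have "x \<in> neighbours D v" using \<open>e \<in> edges D\<close> by (simp add: neighbours_def)
    then show ?thesis using nbr \<open>e = {x, v}\<close> by auto
  qed
  let ?A = "{e \<in> edges D. v \<notin> e \<and> (\<forall>u\<in>e. y u)}"
  have "{e \<in> edges D. \<forall>u\<in>e. (y(v := b)) u} = (if b \<and> y w then insert {v, w} ?A else ?A)"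
    using vw \<open>w \<noteq> v\<close> by (auto dest: at_v split: if_splits)
  moreover have "{v, w} \<notin> ?A" "finite ?A" using fin by auto
  ultimately show ?thesis by auto
qed

text \<open>As \<open>v\<close> is neither an input nor an output, flipping its bit stays inside the
  same sum and keeps the ket. Up to scalars, a pair of such terms depends on the two angles only
  through their sum.\<close>

lemma same_map_redistributed:
  assumes graph: "open_graph D" and v: "YZ_measured D v \<alpha>" "v \<notin> inputs D"
    and nbr: "neighbours D v = {w}" and w: "XY_measured D w \<beta>"
    and red: "redistributed D D' v w \<alpha> \<beta> \<alpha>'"
  shows "same_map D D'"
proof -
  define \<beta>' where "\<beta>' = \<alpha> - \<alpha>' + \<beta>"
  have fields: "verts D' = verts D" "edges D' = edges D" "inputs D' = inputs D" "outputs D' = outputs D"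
    "measured D' = measured D"
    using red by (auto simp: redistributed_def measured_def)
  have mv: "v \<in> measured D" and mw: "w \<in> measured D"
    using v w by (auto simp: YZ_measured_def XY_measured_def)
  have "w \<noteq> v"
    using not_neighbour_self[OF graph, of v] nbr by auto
  have fin: "finite (measured D)" using graph by (simp add: open_graph_def measured_def)
  obtain a where a: "a \<noteq> 0" "\<And>b. eff D v b = a * yz_effect \<alpha> b"
    using v same_effectD unfolding YZ_measured_def by metis
  obtain a' where a': "a' \<noteq> 0" "\<And>b. eff D' v b = a' * yz_effect \<alpha>' b"
    using red same_effectD unfolding redistributed_def YZ_measured_def by metis
  obtain d where d: "d \<noteq> 0" "\<And>b. eff D w b = d * xy_effect \<beta> b"
    using w same_effectD unfolding XY_measured_def by metis
  obtain d' where d': "d' \<noteq> 0" "\<And>b. eff D' w b = d' * xy_effect \<beta>' b"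
    using red same_effectD unfolding redistributed_def XY_measured_def \<beta>'_def by metis
  define M where "M = measured D - {v, w}"
  have "\<forall>u\<in>M. \<exists>c. c \<noteq> 0 \<and> (\<forall>b. eff D' u b = c * eff D u b)"
    using red by (auto simp: redistributed_def same_effect_def M_def)
  then obtain c where c: "\<And>u. u \<in> M \<Longrightarrow> c u \<noteq> 0" "\<And>u b. u \<in> M \<Longrightarrow> eff D' u b = c u * eff D u b"
    by metis
  \<comment> \<open>This collects the rescalings of the other effects and the ratio of the scalars
    at \<open>v\<close> and \<open>w\<close>.\<close>
  define k where "k = prod c M * (a' * d') / (a * d)"
  have "finite M" using fin by (simp add: M_def)
  then have k: "k \<noteq> 0" using c(1) a a' d d' by (simp add: k_def)
  define F :: "'a diagram \<Rightarrow> ('a \<Rightarrow> bool) \<Rightarrow> complex" where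
    "F E y = (-1) ^ card {e \<in> edges D. \<forall>u\<in>e. y u} * (\<Prod>u\<in>measured D. eff E u (y u))" for E y
  have F_split: "F E (y(v := b)) = (-1) ^ card {e \<in> edges D. v \<notin> e \<and> (\<forall>u\<in>e. y u)}
     * (\<Prod>u\<in>M. eff E u (y u)) * (eff E w (y w) * ((if b \<and> y w then -1 else 1) * eff E v b))" for E y b
  proof -
    have "measured D = insert v (insert w M)" "v \<notin> insert w M" "w \<notin> M"
      using mv mw \<open>w \<noteq> v\<close> by (auto simp: M_def)
    moreover have "(\<Prod>u\<in>M. eff E u ((y(v := b)) u)) = (\<Prod>u\<in>M. eff E u (y u))"
      by (rule prod.cong) (auto simp: M_def)
    ultimately have "(\<Prod>u\<in>measured D. eff E u ((y(v := b)) u))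
      = eff E v b * (eff E w (y w) * (\<Prod>u\<in>M. eff E u (y u)))"
      using \<open>finite M\<close> \<open>w \<noteq> v\<close> by simp
    then show ?thesis
      unfolding F_def edge_count[OF graph nbr] by (simp add: power_add)
  qed
  have pair: "F E y + F E (y(v := \<not> y v)) = (-1) ^ card {e \<in> edges D. v \<notin> e \<and> (\<forall>u\<in>e. y u)}
     * (\<Prod>u\<in>M. eff E u (y u)) * (eff E w (y w) * (eff E v False + (if y w then -1 else 1) * eff E v True))" for E y
  proof -
    have "F E y + F E (y(v := \<not> y v)) = F E (y(v := False)) + F E (y(v := True))"
      by (cases "y v") (simp_all add: fun_upd_idem)
    then show ?thesis by (simp add: F_split algebra_simps)
  qed
  have pair_eq: "F D' y + F D' (y(v := \<not> y v)) = k * (F D y + F D (y(v := \<not> y v)))" for y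
  proof -
    have "(\<Prod>u\<in>M. eff D' u (y u)) = prod c M * (\<Prod>u\<in>M. eff D u (y u))"
      by (simp add: c(2) prod.distrib)
    moreover have "eff D' w t * (eff D' v False + (if t then -1 else 1) * eff D' v True)
      = (a' * d') / (a * d) * (eff D w t * (eff D v False + (if t then -1 else 1) * eff D v True))" for t
    proof -
      have "eff D w t * (eff D v False + (if t then -1 else 1) * eff D v True)
        = a * d * (xy_effect \<beta> t * (yz_effect \<alpha> False + (if t then -1 else 1) * yz_effect \<alpha> True))"
        by (simp add: a(2) d(2) algebra_simps)
      moreover have "eff D' w t * (eff D' v False + (if t then -1 else 1) * eff D' v True)
        = a' * d' * (xy_effect \<beta>' t * (yz_effect \<alpha>' False + (if t then -1 else 1) * yz_effect \<alpha>' True))"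
        by (simp add: a'(2) d'(2) algebra_simps)
      moreover have "\<alpha>' + \<beta>' = \<alpha> + \<beta>" by (simp add: \<beta>'_def)
      ultimately show ?thesis
        unfolding yz_xy_contract using a(1) d(1) by simp
    qed
    ultimately show ?thesis unfolding pair by (simp add: k_def)
  qed
  have "interp_ket D' x z = k * interp_ket D x z" for x z
  proof -
    define A where "A = {y \<in> basis (verts D). restrict y (inputs D) = x}"
    define h where "h y = y(v := \<not> y v)" for y :: "'a \<Rightarrow> bool"
    define K where "K y = ket (restrict y (outputs D)) z" for y
    have finA: "finite A"
      using graph by (simp add: A_def basis_def open_graph_def finite_PiE)
    have restr: "restrict (h y) S = restrict y S" if "v \<notin> S" for y S
      using that by (auto simp: h_def restrict_def)
    have "v \<in> verts D" "v \<notin> outputs D" using mv by (auto simp: measured_def)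
    then have hA: "h y \<in> A" if "y \<in> A" for y
      using that restr[of "inputs D" y] v(2) by (auto simp: A_def basis_def h_def PiE_iff extensional_def)
    have Kh: "K (h y) = K y" for y
      using restr[of "outputs D" y] \<open>v \<notin> outputs D\<close> by (simp add: K_def)
    have hh: "h (h y) = y" for y by (auto simp: h_def)
    have pairs: "2 * (\<Sum>y\<in>A. F E y * K y) = (\<Sum>y\<in>A. (F E y + F E (h y)) * K y)" for E
      using sum_pair[of A h "\<lambda>y. F E y * K y"] finA hA hh by (simp add: Kh distrib_right)
    have "2 * (\<Sum>y\<in>A. F D' y * K y) = k * (2 * (\<Sum>y\<in>A. F D y * K y))"
      unfolding pairs h_def pair_eq by (simp add: sum_distrib_left mult.assoc)
    then have "(\<Sum>y\<in>A. F D' y * K y) = k * (\<Sum>y\<in>A. F D y * K y)" by simp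
    then show ?thesis
      by (simp add: interp_ket_def fields A_def F_def K_def)
  qed
  then have "interp D' \<psi> z = k * interp D \<psi> z" for \<psi> z
    by (simp add: interp_def fields sum_distrib_left mult.left_commute)
  then show ?thesis using k fields by (auto simp: same_map_def)
qed

section \<open>Flows of diagrams under redistribution\<close>

text \<open>Labels of different vertices are chosen independently, so maximality is a vertexwise
  property: replacing a single planar label by an available Pauli one raises the count.\<close>

lemma is_arg_max_pauli_count_iff:
  assumes graph: "open_graph D"
  shows "is_arg_max pauli_count (corresponds D) \<Gamma> \<longleftrightarrow> corresponds D \<Gamma>
    \<and> (\<forall>u\<in>measured D. \<forall>l. pauli_label l \<and> effect_of_type l (eff D u) \<longrightarrow> pauli_label (lab \<Gamma> u))"
    (is "_ \<longleftrightarrow> _ \<and> ?max")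
proof -
  have fin: "finite (measured D)"
    using graph by (simp add: open_graph_def measured_def)
  have measured_eq: "measured \<Delta> = measured D" if "corresponds D \<Delta>" for \<Delta>
    using that by (simp add: corresponds_def measured_def)
  have "?max" if arg_max: "is_arg_max pauli_count (corresponds D) \<Gamma>"
  proof (intro ballI allI impI, rule ccontr)
    fix u l
    assume u: "u \<in> measured D" and l: "pauli_label l \<and> effect_of_type l (eff D u)"
      and not_pauli: "\<not> pauli_label (lab \<Gamma> u)"
    define \<Delta> where "\<Delta> = \<Gamma>\<lparr>lab := (lab \<Gamma>)(u := l)\<rparr>"
    have \<Gamma>: "corresponds D \<Gamma>" using arg_max by (simp add: is_arg_max_def)
    then have "corresponds D \<Delta>"
      using u l measured_eq[OF \<Gamma>]
      by (auto simp: corresponds_def labelled_open_graph_def \<Delta>_def PiE_iff extensional_def)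
    have "{x \<in> measured \<Gamma>. pauli_label (lab \<Gamma> x)} \<subset> {x \<in> measured \<Delta>. pauli_label (lab \<Delta> x)}"
      using u l not_pauli measured_eq[OF \<Gamma>] by (auto simp: \<Delta>_def)
    then have "pauli_count \<Gamma> < pauli_count \<Delta>"
      unfolding pauli_count_def using fin measured_eq[OF \<open>corresponds D \<Delta>\<close>]
      by (intro psubset_card_mono) auto
    then show False
      using arg_max \<open>corresponds D \<Delta>\<close> by (simp add: is_arg_max_def)
  qed
  moreover have "is_arg_max pauli_count (corresponds D) \<Gamma>" if \<Gamma>: "corresponds D \<Gamma>" and max: ?max
  proof -
    have "pauli_count \<Delta> \<le> pauli_count \<Gamma>" if "corresponds D \<Delta>" for \<Delta>
      unfolding pauli_count_def measured_eq[OF \<Gamma>] measured_eq[OF that]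
    proof (rule card_mono)
      show "{x \<in> measured D. pauli_label (lab \<Delta> x)} \<subseteq> {x \<in> measured D. pauli_label (lab \<Gamma> x)}"
        using max that unfolding corresponds_def by blast
    qed (use fin in simp)
    then show ?thesis using \<Gamma> by (auto simp: is_arg_max_def not_less)
  qed
  ultimately show ?thesis by (auto simp: is_arg_max_def)
qed

section \<open>Labels determined by the angles\<close>

definition yz_max_label :: "real \<Rightarrow> label" where
  "yz_max_label \<alpha> = (if sin \<alpha> = 0 then Z else if cos \<alpha> = 0 then Y else YZ)"

definition xy_max_label :: "real \<Rightarrow> label" where
  "xy_max_label \<alpha> = (if sin \<alpha> = 0 then X else if cos \<alpha> = 0 then Y else XY)"

lemma sin_cos_not_both_zero: "sin (x :: real) = 0 \<Longrightarrow> cos x \<noteq> 0"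
  using sin_zero_norm_cos_one[of x] by auto

text \<open>The last fact is uniqueness: in every labelling with the most Pauli labels, the angle
  determines the label.\<close>

lemma yz_max_label:
  assumes "same_effect e (yz_effect \<alpha>)"
  shows "effect_of_type (yz_max_label \<alpha>) e"
    and "pauli_label l \<Longrightarrow> effect_of_type l e \<Longrightarrow> pauli_label (yz_max_label \<alpha>)"
    and "effect_of_type l e \<Longrightarrow> pauli_label l \<or> \<not> pauli_label (yz_max_label \<alpha>) \<Longrightarrow> l = yz_max_label \<alpha>"
proof -
  show "effect_of_type (yz_max_label \<alpha>) e"
    using yz_effect_Pauli[OF assms] assms by (auto simp: yz_max_label_def)
  show "pauli_label l \<Longrightarrow> effect_of_type l e \<Longrightarrow> pauli_label (yz_max_label \<alpha>)"
    using same_effect_yz_type[OF assms, of l] by (auto simp: yz_max_label_def pauli_label_def)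
  show "effect_of_type l e \<Longrightarrow> pauli_label l \<or> \<not> pauli_label (yz_max_label \<alpha>) \<Longrightarrow> l = yz_max_label \<alpha>"
    using same_effect_yz_type[OF assms, of l] sin_cos_not_both_zero[of \<alpha>]
    by (cases l) (auto simp: yz_max_label_def pauli_label_def split: if_splits)
qed

lemma xy_max_label:
  assumes "same_effect e (xy_effect \<alpha>)"
  shows "effect_of_type (xy_max_label \<alpha>) e"
    and "pauli_label l \<Longrightarrow> effect_of_type l e \<Longrightarrow> pauli_label (xy_max_label \<alpha>)"
    and "effect_of_type l e \<Longrightarrow> pauli_label l \<or> \<not> pauli_label (xy_max_label \<alpha>) \<Longrightarrow> l = xy_max_label \<alpha>"
proof -
  show "effect_of_type (xy_max_label \<alpha>) e"
    using xy_effect_Pauli[OF assms] assms unfolding xy_max_label_def by (simp del: effect_of_type.simps(4,5)) blast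
  show "pauli_label l \<Longrightarrow> effect_of_type l e \<Longrightarrow> pauli_label (xy_max_label \<alpha>)"
    using same_effect_xy_type[OF assms, of l] by (auto simp: xy_max_label_def pauli_label_def)
  show "effect_of_type l e \<Longrightarrow> pauli_label l \<or> \<not> pauli_label (xy_max_label \<alpha>) \<Longrightarrow> l = xy_max_label \<alpha>"
    using same_effect_xy_type[OF assms, of l] sin_cos_not_both_zero[of \<alpha>]
    by (cases l) (auto simp: xy_max_label_def pauli_label_def split: if_splits)
qed

text \<open>The labels are \<open>(Z, X)\<close> or \<open>(Y, Y)\<close> if the preserved sum of the angles is a multiple of \<open>\<pi>\<close>,
  and \<open>(Z, Y)\<close> or \<open>(Y, X)\<close> otherwise.\<close>

lemma max_labels_redistributed:
  assumes "both_pauli \<alpha> \<beta>" "both_pauli \<alpha>' \<beta>'" "\<alpha> + \<beta> = \<alpha>' + \<beta>'"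
  shows "(yz_max_label \<alpha>' = yz_max_label \<alpha> \<and> xy_max_label \<beta>' = xy_max_label \<beta>)
    \<or> (yz_max_label \<alpha>' = swap_v (yz_max_label \<alpha>)
       \<and> xy_max_label \<beta>' = swap_w (xy_max_label \<beta>))"
proof -
  \<comment> \<open>Exactly one of sine and cosine vanishes at each angle. In the addition formula
    both products vanish if the angles are of the same kind, and exactly one does otherwise.\<close>
  have "(sin \<alpha> = 0) = (sin \<beta> = 0) \<longleftrightarrow> sin (\<alpha> + \<beta>) = 0" if "both_pauli \<alpha> \<beta>" for \<alpha> \<beta>
    using that sin_cos_not_both_zero[of \<alpha>] sin_cos_not_both_zero[of \<beta>]
    by (auto simp: both_pauli_def pauli_angle_iff sin_add)
  then have "((sin \<alpha> = 0) = (sin \<beta> = 0)) = ((sin \<alpha>' = 0) = (sin \<beta>' = 0))"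
    using assms by metis
  then show ?thesis
    using assms(1,2)
    by (auto simp: both_pauli_def pauli_angle_iff yz_max_label_def xy_max_label_def)
qed

text \<open>Naming the new angle \<open>\<beta>'\<close> makes the situation symmetric in the two
  diagrams, so each transfer is proved in one direction and used in both.\<close>

locale redistribution =
  fixes D D' :: "'a diagram" and v w :: 'a and \<alpha> \<beta> \<alpha>' \<beta>' :: real
  assumes graph: "open_graph D"
    and v: "YZ_measured D v \<alpha>" "v \<notin> inputs D"
    and nbr: "neighbours D v = {w}"
    and w: "XY_measured D w \<beta>"
    and red: "redistributed D D' v w \<alpha> \<beta> \<alpha>'"
    and \<beta>': "\<beta>' = \<alpha> - \<alpha>' + \<beta>"
begin

section \<open>Transfer of flows from one diagram to the other\<close>

lemma fields:
  "verts D' = verts D" "edges D' = edges D" "inputs D' = inputs D" "outputs D' = outputs D"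
  "measured D' = measured D"
  using red by (auto simp: redistributed_def measured_def)

lemma effects:
  "v \<in> measured D" "w \<in> measured D"
  "same_effect (eff D v) (yz_effect \<alpha>)" "same_effect (eff D w) (xy_effect \<beta>)"
  "same_effect (eff D' v) (yz_effect \<alpha>')" "same_effect (eff D' w) (xy_effect \<beta>')"
  using v w red by (auto simp: redistributed_def YZ_measured_def XY_measured_def \<beta>')

lemma effect_of_type_other:
  "u \<in> measured D \<Longrightarrow> u \<noteq> v \<Longrightarrow> u \<noteq> w \<Longrightarrow> effect_of_type l (eff D' u) \<longleftrightarrow> effect_of_type l (eff D u)"
  using red effect_of_type_cong unfolding redistributed_def by blast

lemma redistribution_sym: "redistribution D' D v w \<alpha>' \<beta>' \<alpha> \<beta>"
proof
  have "neighbours D' v = neighbours D v"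
    by (simp add: neighbours_def fields)
  then show "neighbours D' v = {w}" by (simp add: nbr)
  show "redistributed D' D v w \<alpha>' \<beta>' \<alpha>"
    using red v w \<beta>' by (auto simp: redistributed_def measured_def intro: same_effect_sym)
qed (use graph v red \<beta>' fields effects in \<open>auto simp: open_graph_def YZ_measured_def XY_measured_def\<close>)

lemma pendant: "corresponds D \<Gamma> \<Longrightarrow> pendant \<Gamma> v w"
  using v w nbr by unfold_locales
    (auto simp: corresponds_def labelled_open_graph_def measured_def YZ_measured_def XY_measured_def
      neighbours_def)

lemma corresponds_redistributed:
  assumes "corresponds D \<Gamma>" "effect_of_type a (eff D' v)" "effect_of_type b (eff D' w)"
  shows "corresponds D' (\<Gamma>\<lparr>lab := (lab \<Gamma>)(v := a, w := b)\<rparr>)"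
proof -
  have "measured \<Gamma> = measured D" using assms(1) by (simp add: corresponds_def measured_def)
  then show ?thesis
    using assms effects(1,2) effect_of_type_other
    by (auto simp: corresponds_def labelled_open_graph_def fields PiE_iff extensional_def)
qed

text \<open>The implication excludes exactly the passage from two Pauli effects to a pair that is
  not doubly Pauli.\<close>

lemma diagram_pauli_flow_redistributed:
  assumes flow: "diagram_pauli_flow D" and pauli: "both_pauli \<alpha> \<beta> \<longrightarrow> both_pauli \<alpha>' \<beta>'"
  shows "diagram_pauli_flow D'"
proof -
  obtain \<Gamma> where arg_max: "is_arg_max pauli_count (corresponds D) \<Gamma>" and "has_pauli_flow \<Gamma>"
    using flow by (auto simp: diagram_pauli_flow_def)
  then have \<Gamma>: "corresponds D \<Gamma>" and max: "\<And>u l. u \<in> measured D \<Longrightarrow> pauli_label l \<Longrightarrow>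
      effect_of_type l (eff D u) \<Longrightarrow> pauli_label (lab \<Gamma> u)"
    using is_arg_max_pauli_count_iff[OF graph] by auto
  interpret pendant \<Gamma> v w using pendant[OF \<Gamma>] .
  obtain p r where p: "ranked_flow \<Gamma> p r"
    using \<open>has_pauli_flow \<Gamma>\<close> has_pauli_flow_iff_ranked[OF graph] by blast
  have type: "effect_of_type (lab \<Gamma> u) (eff D u)" if "u \<in> measured D" for u
    using \<Gamma> that by (simp add: corresponds_def)
  have labels: "lab \<Gamma> v = yz_max_label \<alpha>" "lab \<Gamma> w = xy_max_label \<beta>"
    using yz_max_label[OF effects(3)] xy_max_label[OF effects(4)] type max effects(1,2) by metis+
  define f where "f = (lab \<Gamma>)(v := yz_max_label \<alpha>', w := xy_max_label \<beta>')"
  have \<Delta>: "corresponds D' (\<Gamma>\<lparr>lab := f\<rparr>)"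
    unfolding f_def
    using corresponds_redistributed[OF \<Gamma>] yz_max_label(1)[OF effects(5)] xy_max_label(1)[OF effects(6)] by blast
  have "pauli_label (f u)" if "u \<in> measured D" "pauli_label l" "effect_of_type l (eff D' u)" for u l
    using that yz_max_label(2)[OF effects(5), of l] xy_max_label(2)[OF effects(6), of l]
      max[of u l] effect_of_type_other[of u l] by (auto simp: f_def)
  moreover have "open_graph D'" using redistribution_sym by (simp add: redistribution_def)
  ultimately have "is_arg_max pauli_count (corresponds D') (\<Gamma>\<lparr>lab := f\<rparr>)"
    by (auto simp: is_arg_max_pauli_count_iff \<Delta> fields(5))
  moreover have "\<exists>p r. ranked_flow (\<Gamma>\<lparr>lab := f\<rparr>) p r"
  proof (cases "both_pauli \<alpha> \<beta>")
    case True
    then have "f = lab \<Gamma> \<or> f = (lab \<Gamma>)(v := swap_v (lab \<Gamma> v), w := swap_w (lab \<Gamma> w))"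
      using max_labels_redistributed[of \<alpha> \<beta> \<alpha>' \<beta>'] pauli \<beta>'
      unfolding f_def labels by (auto simp flip: labels)
    moreover have "lab \<Gamma> v \<in> {Y, Z}" "lab \<Gamma> w \<in> {X, Y}"
      using True by (auto simp: labels both_pauli_def pauli_angle_iff yz_max_label_def xy_max_label_def)
    ultimately show ?thesis using p ranked_flow_swap[OF p]
      by (elim disjE) (auto intro!: exI)
  next
    case False
    \<comment> \<open>A vertex whose angle is not Pauli carries its planar label \<open>YZ\<close>
      or \<open>XY\<close>.\<close>
    then have "(lab \<Gamma> w = XY \<and> lab \<Gamma> v \<noteq> X) \<or> (lab \<Gamma> v = YZ \<and> lab \<Gamma> w \<noteq> Z)"
      by (auto simp: labels both_pauli_def pauli_angle_iff yz_max_label_def xy_max_label_def)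
    then obtain p' r' where p': "ranked_flow (\<Gamma>\<lparr>lab := (lab \<Gamma>)(v := YZ, w := XY)\<rparr>) p' r'"
      using ranked_flow_YZ_XY[OF p] by blast
    have "ranked_flow (\<Gamma>\<lparr>lab := (lab \<Gamma>)(v := YZ, w := XY)\<rparr>\<lparr>lab := f\<rparr>) p' r'"
      by (rule ranked_flow_special_case[OF p'])
         (auto simp: f_def yz_max_label_def xy_max_label_def)
    then show ?thesis by auto
  qed
  ultimately show ?thesis
    using has_pauli_flow_iff_ranked[of "\<Gamma>\<lparr>lab := f\<rparr>"] graph
    unfolding diagram_pauli_flow_def lab_update_simps by blast
qed

text \<open>The conclusion exposes the labels and correction sets, so that gflow and extended causal
  flow can both be read off.\<close>

lemma planar_flow_redistributed:
  assumes \<Gamma>: "corresponds D \<Gamma>" and planar: "\<forall>u\<in>measured \<Gamma>. planar_label (lab \<Gamma> u)"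
    and flow: "ranked_flow \<Gamma> p r"
  shows "\<exists>\<Delta> p' r'. corresponds D' \<Delta> \<and> ranked_flow \<Delta> p' r'
    \<and> lab \<Delta> = (lab \<Gamma>)(v := YZ, w := XY) \<and> measured \<Delta> = measured \<Gamma> \<and> (\<forall>u. p' u = p u \<or> p' u = {v})"
proof -
  interpret pendant \<Gamma> v w using pendant[OF \<Gamma>] .
  have "planar_label (lab \<Gamma> v)" "planar_label (lab \<Gamma> w)"
    using planar pendant.v(1)[OF pendant_axioms] pendant.w[OF pendant_axioms] by auto
  then obtain p' r' where "ranked_flow (\<Gamma>\<lparr>lab := (lab \<Gamma>)(v := YZ, w := XY)\<rparr>) p' r'"
      "\<forall>u. p' u = p u \<or> p' u = {v}"
    using ranked_flow_YZ_XY[OF flow] planar_flow_labels[OF flow] by (auto simp: planar_label_def)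
  moreover have "corresponds D' (\<Gamma>\<lparr>lab := (lab \<Gamma>)(v := YZ, w := XY)\<rparr>)"
    using effects by (intro corresponds_redistributed[OF \<Gamma>]) auto
  ultimately show ?thesis
    by (intro exI[of _ "\<Gamma>\<lparr>lab := (lab \<Gamma>)(v := YZ, w := XY)\<rparr>"]) auto
qed

lemma diagram_gflow_redistributed:
  assumes "diagram_gflow D"
  shows "diagram_gflow D'"
proof -
  obtain \<Gamma> where \<Gamma>: "corresponds D \<Gamma>" "has_gflow \<Gamma>"
    using assms by (auto simp: diagram_gflow_def)
  then have "open_graph \<Gamma>" by (simp add: corresponds_def labelled_open_graph_def)
  then obtain p r where "ranked_flow \<Gamma> p r"
    using \<Gamma>(2) has_pauli_flow_iff_ranked unfolding has_gflow_def by blast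
  then obtain \<Delta> p' r' where \<Delta>: "corresponds D' \<Delta>" "ranked_flow \<Delta> p' r'"
      "lab \<Delta> = (lab \<Gamma>)(v := YZ, w := XY)" "measured \<Delta> = measured \<Gamma>"
    using planar_flow_redistributed[OF \<Gamma>(1)] \<Gamma>(2) unfolding has_gflow_def by metis
  then have "has_pauli_flow \<Delta>"
    using has_pauli_flow_iff_ranked[of \<Delta>] by (auto simp: corresponds_def labelled_open_graph_def)
  then have "has_gflow \<Delta>"
    using \<Gamma>(2) \<Delta>(3,4) by (simp add: has_gflow_def planar_label_def)
  then show ?thesis using \<Delta>(1) by (auto simp: diagram_gflow_def)
qed

lemma diagram_extended_causal_flow_redistributed:
  assumes "diagram_extended_causal_flow D"
  shows "diagram_extended_causal_flow D'"
proof -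
  obtain \<Gamma> where \<Gamma>: "corresponds D \<Gamma>" "has_extended_causal_flow \<Gamma>"
    using assms by (auto simp: diagram_extended_causal_flow_def)
  then have "open_graph \<Gamma>" by (simp add: corresponds_def labelled_open_graph_def)
  then obtain f r where labels: "\<forall>u\<in>measured \<Gamma>. lab \<Gamma> u \<in> {XY, YZ}"
      and flow: "ranked_flow \<Gamma> (\<lambda>u. {f u}) r"
    using \<Gamma>(2) has_extended_causal_flow_iff_ranked by blast
  have "\<forall>u\<in>measured \<Gamma>. planar_label (lab \<Gamma> u)"
    using labels by (auto simp: planar_label_def)
  then obtain \<Delta> p' r' where \<Delta>: "corresponds D' \<Delta>" "ranked_flow \<Delta> p' r'"
      "lab \<Delta> = (lab \<Gamma>)(v := YZ, w := XY)" "measured \<Delta> = measured \<Gamma>"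
      "\<forall>u. p' u = {f u} \<or> p' u = {v}"
    using planar_flow_redistributed[OF \<Gamma>(1) _ flow] by blast
  \<comment> \<open>As \<open>{v}\<close> is a singleton too, the new correction sets still come
    from a map.\<close>
  from \<Delta>(5) have "\<exists>f'. \<forall>u. p' u = {f' u}" by (intro choice) blast
  then obtain f' where "p' = (\<lambda>u. {f' u})" by auto
  then have "has_extended_causal_flow \<Delta>"
    using has_extended_causal_flow_iff_ranked[of \<Delta>] labels \<Delta>
    by (auto simp: corresponds_def labelled_open_graph_def)
  then show ?thesis using \<Delta>(1) by (auto simp: diagram_extended_causal_flow_def)
qed

end

theorem lemma24:
  fixes D D' :: "'a diagram" and v w :: 'a and \<alpha> \<beta> \<alpha>' :: real
  assumes "mbqc_form D"
    and "YZ_measured D v \<alpha>" and "v \<notin> inputs D"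
    and "neighbours D v = {w}" and "XY_measured D w \<beta>"
    and "redistributed D D' v w \<alpha> \<beta> \<alpha>'"
  shows "same_map D D'
    \<and> ((both_pauli \<alpha> \<beta> \<longleftrightarrow> both_pauli \<alpha>' (\<alpha> - \<alpha>' + \<beta>)) \<longrightarrow>
          (diagram_pauli_flow D' \<longleftrightarrow> diagram_pauli_flow D))
    \<and> (both_pauli \<alpha>' (\<alpha> - \<alpha>' + \<beta>) \<longrightarrow> diagram_pauli_flow D \<longrightarrow> diagram_pauli_flow D')
    \<and> (both_pauli \<alpha> \<beta> \<longrightarrow> diagram_pauli_flow D' \<longrightarrow> diagram_pauli_flow D)
    \<and> (diagram_gflow D' \<longleftrightarrow> diagram_gflow D)
    \<and> (diagram_extended_causal_flow D' \<longleftrightarrow> diagram_extended_causal_flow D)"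
proof -
  have graph: "open_graph D"
    using assms(1) by (simp add: mbqc_form_def)
  interpret redistribution D D' v w \<alpha> \<beta> \<alpha>' "\<alpha> - \<alpha>' + \<beta>"
    by unfold_locales (use graph assms in auto)
  interpret sym: redistribution D' D v w \<alpha>' "\<alpha> - \<alpha>' + \<beta>" \<alpha> \<beta>
    by (rule redistribution_sym)
  show ?thesis
    using same_map_redistributed[OF graph assms(2-6)]
      diagram_pauli_flow_redistributed sym.diagram_pauli_flow_redistributed
      diagram_gflow_redistributed sym.diagram_gflow_redistributed
      diagram_extended_causal_flow_redistributed sym.diagram_extended_causal_flow_redistributed
    by blast
qed

end
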